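(* Any weakly cartesian natural transformation between polynomial functors is cartesian. That is, if $O$ is a set, $P,R:\mathbf{Set}_{/O}\to\mathbf{Set}_{/O}$ are polynomial functors and $\tau:P\to R$ is a natural transformation all of whose naturality squares are weak pullbacks, then all naturality squares of $\tau$ are pullbacks.
   Context: For a function $u$ between sets, $u^*$ denotes the pullback functor between slices of $\mathbf{Set}$, $u_!$ its left adjoint (composition with $u$) and $u_*$ its right adjoint. A polynomial diagram over a set $O$ is a diagram of sets and functions $O\xleftarrow{s}E\xrightarrow{p}A\xrightarrow{t}O$. A functor $P:\mathbf{Set}_{/O}\to\mathbf{Set}_{/O}$ is a polynomial functor if it is isomorphic to $t_!p_*s^*$ for some polynomial diagram $(t,p,s)$ over $O$. *)

theory Defs
  imports Main "HOL-Library.FuncSet"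
begin

text \<open>
  A type \<open>'x\<close> plays the role of a universe: the category
  \<open>Set('x)\<close> has all sets of elements of type \<open>'x\<close> as objects and all functions between them as
  arrows, a function with domain \<open>X\<close> being represented extensionally (\<open>X \<rightarrow>\<^sub>E Y\<close>), so that equality
  of arrows is HOL equality.

  In general a HOL type is not closed under dependent products, so the explicit functors
  \<open>u\<^sup>*\<close> and \<open>u\<^sub>*\<close> below change the universe, and maps and natural transformations are allowed
  to go between sets in different universes. Consequently functors on the slice over \<open>I\<close> are
  taken from \<open>Set('x)/I\<close> to \<open>Set('y)/I\<close> for arbitrary universes \<open>'x\<close> and \<open>'y\<close>; endofunctors
  are the instance \<open>'y = 'x\<close>. The universes are type variables, hence can be instantiated with
  arbitrarily large types.
\<close>

section \<open>Slice categories\<close>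

record ('x, 'i) over =
  tot :: "'x set"
  proj :: "'x \<Rightarrow> 'i"

definition slice :: "'i set \<Rightarrow> ('x, 'i) over set" where
  "slice I = {X. proj X \<in> tot X \<rightarrow>\<^sub>E I}"

definition slice_hom :: "('x, 'i) over \<Rightarrow> ('y, 'i) over \<Rightarrow> ('x \<Rightarrow> 'y) set" where
  "slice_hom X Y = {h \<in> tot X \<rightarrow>\<^sub>E tot Y. compose (tot X) (proj Y) h = proj X}"

definition slice_id :: "('x, 'i) over \<Rightarrow> 'x \<Rightarrow> 'x" where
  "slice_id X = (\<lambda>x\<in>tot X. x)"

definition slice_comp :: "('x, 'i) over \<Rightarrow> ('y \<Rightarrow> 'z) \<Rightarrow> ('x \<Rightarrow> 'y) \<Rightarrow> 'x \<Rightarrow> 'z" where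
  \<comment> \<open>composite \<open>g \<circ> f\<close>, where \<open>X\<close> is the domain of \<open>f\<close>\<close>
  "slice_comp X g f = compose (tot X) g f"

definition slice_iso :: "('x, 'i) over \<Rightarrow> ('y, 'i) over \<Rightarrow> ('x \<Rightarrow> 'y) \<Rightarrow> bool" where
  "slice_iso X Y h \<longleftrightarrow> h \<in> slice_hom X Y \<and>
     (\<exists>k\<in>slice_hom Y X. slice_comp X k h = slice_id X \<and> slice_comp Y h k = slice_id Y)"

text \<open>
  The squares below are
  \<open>p : W \<rightarrow> X\<close>, \<open>q : W \<rightarrow> Y\<close>, \<open>f : X \<rightarrow> Z\<close>, \<open>g : Y \<rightarrow> Z\<close> with \<open>f \<circ> p = g \<circ> q\<close>.
\<close>

definition commuting_square ::
  "'i set \<Rightarrow> ('x, 'i) over \<Rightarrow> ('x, 'i) over \<Rightarrow> ('x, 'i) over \<Rightarrow> ('x, 'i) over \<Rightarrow>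
   ('x \<Rightarrow> 'x) \<Rightarrow> ('x \<Rightarrow> 'x) \<Rightarrow> ('x \<Rightarrow> 'x) \<Rightarrow> ('x \<Rightarrow> 'x) \<Rightarrow> bool" where
  "commuting_square I W X Y Z p q f g \<longleftrightarrow>
     {W, X, Y, Z} \<subseteq> slice I \<and>
     p \<in> slice_hom W X \<and> q \<in> slice_hom W Y \<and> f \<in> slice_hom X Z \<and> g \<in> slice_hom Y Z \<and>
     slice_comp W f p = slice_comp W g q"

definition weak_pullback ::
  "'i set \<Rightarrow> ('x, 'i) over \<Rightarrow> ('x, 'i) over \<Rightarrow> ('x, 'i) over \<Rightarrow> ('x, 'i) over \<Rightarrow>
   ('x \<Rightarrow> 'x) \<Rightarrow> ('x \<Rightarrow> 'x) \<Rightarrow> ('x \<Rightarrow> 'x) \<Rightarrow> ('x \<Rightarrow> 'x) \<Rightarrow> bool" where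
  "weak_pullback I W X Y Z p q f g \<longleftrightarrow>
     commuting_square I W X Y Z p q f g \<and>
     (\<forall>V\<in>(slice I :: ('x, 'i) over set). \<forall>u\<in>slice_hom V X. \<forall>v\<in>slice_hom V Y.
        slice_comp V f u = slice_comp V g v \<longrightarrow>
        (\<exists>h\<in>slice_hom V W. slice_comp V p h = u \<and> slice_comp V q h = v))"

definition pullback ::
  "'i set \<Rightarrow> ('x, 'i) over \<Rightarrow> ('x, 'i) over \<Rightarrow> ('x, 'i) over \<Rightarrow> ('x, 'i) over \<Rightarrow>
   ('x \<Rightarrow> 'x) \<Rightarrow> ('x \<Rightarrow> 'x) \<Rightarrow> ('x \<Rightarrow> 'x) \<Rightarrow> ('x \<Rightarrow> 'x) \<Rightarrow> bool" where
  "pullback I W X Y Z p q f g \<longleftrightarrow>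
     commuting_square I W X Y Z p q f g \<and>
     (\<forall>V\<in>(slice I :: ('x, 'i) over set). \<forall>u\<in>slice_hom V X. \<forall>v\<in>slice_hom V Y.
        slice_comp V f u = slice_comp V g v \<longrightarrow>
        (\<exists>!h. h \<in> slice_hom V W \<and> slice_comp V p h = u \<and> slice_comp V q h = v))"

section \<open>Functors between slices\<close>

text \<open>
  An arrow does not determine its domain and codomain as objects of the slice, so the action
  \<open>fmap F X Y\<close> on arrows \<open>X \<rightarrow> Y\<close> takes them as arguments.
\<close>

record ('x, 'i, 'y, 'j) slice_fun =
  fobj :: "('x, 'i) over \<Rightarrow> ('y, 'j) over"
  fmap :: "('x, 'i) over \<Rightarrow> ('x, 'i) over \<Rightarrow> ('x \<Rightarrow> 'x) \<Rightarrow> 'y \<Rightarrow> 'y"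

definition slice_functor :: "'i set \<Rightarrow> 'j set \<Rightarrow> ('x, 'i, 'y, 'j) slice_fun \<Rightarrow> bool" where
  "slice_functor I J F \<longleftrightarrow>
     (\<forall>X\<in>slice I. fobj F X \<in> slice J) \<and>
     (\<forall>X\<in>slice I. \<forall>Y\<in>slice I. \<forall>h\<in>slice_hom X Y.
        fmap F X Y h \<in> slice_hom (fobj F X) (fobj F Y)) \<and>
     (\<forall>X\<in>slice I. fmap F X X (slice_id X) = slice_id (fobj F X)) \<and>
     (\<forall>X\<in>slice I. \<forall>Y\<in>slice I. \<forall>Z\<in>slice I. \<forall>h\<in>slice_hom X Y. \<forall>k\<in>slice_hom Y Z.
        fmap F X Z (slice_comp X k h) = slice_comp (fobj F X) (fmap F Y Z k) (fmap F X Y h))"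

definition functor_comp ::
  "('y, 'j, 'z, 'k) slice_fun \<Rightarrow> ('x, 'i, 'y, 'j) slice_fun \<Rightarrow> ('x, 'i, 'z, 'k) slice_fun"
  (infixr \<open>\<circ>\<^sub>F\<close> 55) where
  "G \<circ>\<^sub>F F = \<lparr>fobj = (\<lambda>X. fobj G (fobj F X)),
     fmap = (\<lambda>X Y h. fmap G (fobj F X) (fobj F Y) (fmap F X Y h))\<rparr>"

definition natural_transformation ::
  "'i set \<Rightarrow> ('x, 'i, 'y, 'j) slice_fun \<Rightarrow> ('x, 'i, 'z, 'j) slice_fun \<Rightarrow>
   (('x, 'i) over \<Rightarrow> 'y \<Rightarrow> 'z) \<Rightarrow> bool" where
  "natural_transformation I F G \<tau> \<longleftrightarrow>
     (\<forall>X\<in>slice I. \<tau> X \<in> slice_hom (fobj F X) (fobj G X)) \<and>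
     (\<forall>X\<in>slice I. \<forall>Y\<in>slice I. \<forall>h\<in>slice_hom X Y.
        slice_comp (fobj F X) (\<tau> Y) (fmap F X Y h) = slice_comp (fobj F X) (fmap G X Y h) (\<tau> X))"

definition isomorphic_functors ::
  "'i set \<Rightarrow> ('x, 'i, 'y, 'j) slice_fun \<Rightarrow> ('x, 'i, 'z, 'j) slice_fun \<Rightarrow> bool" where
  "isomorphic_functors I F G \<longleftrightarrow>
     (\<exists>\<tau>. natural_transformation I F G \<tau> \<and> (\<forall>X\<in>slice I. slice_iso (fobj F X) (fobj G X) (\<tau> X)))"

definition weakly_cartesian ::
  "'i set \<Rightarrow> 'j set \<Rightarrow> ('x, 'i, 'y, 'j) slice_fun \<Rightarrow> ('x, 'i, 'y, 'j) slice_fun \<Rightarrow>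
   (('x, 'i) over \<Rightarrow> 'y \<Rightarrow> 'y) \<Rightarrow> bool" where
  "weakly_cartesian I J F G \<tau> \<longleftrightarrow>
     (\<forall>X\<in>slice I. \<forall>Y\<in>slice I. \<forall>h\<in>slice_hom X Y.
        weak_pullback J (fobj F X) (fobj F Y) (fobj G X) (fobj G Y)
          (fmap F X Y h) (\<tau> X) (\<tau> Y) (fmap G X Y h))"

definition cartesian ::
  "'i set \<Rightarrow> 'j set \<Rightarrow> ('x, 'i, 'y, 'j) slice_fun \<Rightarrow> ('x, 'i, 'y, 'j) slice_fun \<Rightarrow>
   (('x, 'i) over \<Rightarrow> 'y \<Rightarrow> 'y) \<Rightarrow> bool" where
  "cartesian I J F G \<tau> \<longleftrightarrow>
     (\<forall>X\<in>slice I. \<forall>Y\<in>slice I. \<forall>h\<in>slice_hom X Y.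
        pullback J (fobj F X) (fobj F Y) (fobj G X) (fobj G Y)
          (fmap F X Y h) (\<tau> X) (\<tau> Y) (fmap G X Y h))"

section \<open>Pullback functors and their adjoints\<close>

definition pull :: "'e set \<Rightarrow> ('e \<Rightarrow> 'i) \<Rightarrow> ('x, 'i, 'x \<times> 'e, 'e) slice_fun" where
  \<comment> \<open>\<open>u\<^sup>*\<close> for \<open>u : E \<rightarrow> I\<close>\<close>
  "pull E u = \<lparr>
     fobj = (\<lambda>X. let T = {(x, e). x \<in> tot X \<and> e \<in> E \<and> proj X x = u e}
                  in \<lparr>tot = T, proj = restrict snd T\<rparr>),
     fmap = (\<lambda>X Y h. \<lambda>(x, e)\<in>{(x, e). x \<in> tot X \<and> e \<in> E \<and> proj X x = u e}. (h x, e))\<rparr>"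

definition dep_sum :: "('e \<Rightarrow> 'i) \<Rightarrow> ('x, 'e, 'x, 'i) slice_fun" where
  \<comment> \<open>\<open>u\<^sub>!\<close> for \<open>u : E \<rightarrow> I\<close>\<close>
  "dep_sum u = \<lparr>
     fobj = (\<lambda>X. \<lparr>tot = tot X, proj = compose (tot X) u (proj X)\<rparr>),
     fmap = (\<lambda>X Y h. h)\<rparr>"

definition sections :: "'e set \<Rightarrow> ('e \<Rightarrow> 'i) \<Rightarrow> ('x, 'e) over \<Rightarrow> 'i \<Rightarrow> ('e \<Rightarrow> 'x) set" where
  \<comment> \<open>sections of \<open>X\<close> over the fibre of \<open>u\<close> at \<open>i\<close>\<close>
  "sections E u X i =
     {\<sigma> \<in> {e \<in> E. u e = i} \<rightarrow>\<^sub>E tot X. \<forall>e\<in>E. u e = i \<longrightarrow> proj X (\<sigma> e) = e}"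

definition dep_prod :: "'e set \<Rightarrow> 'i set \<Rightarrow> ('e \<Rightarrow> 'i) \<Rightarrow> ('x, 'e, 'i \<times> ('e \<Rightarrow> 'x), 'i) slice_fun" where
  \<comment> \<open>\<open>u\<^sub>*\<close> for \<open>u : E \<rightarrow> I\<close>\<close>
  "dep_prod E I u = \<lparr>
     fobj = (\<lambda>X. let T = Sigma I (sections E u X) in \<lparr>tot = T, proj = restrict fst T\<rparr>),
     fmap = (\<lambda>X Y h. \<lambda>(i, \<sigma>)\<in>Sigma I (sections E u X). (i, compose {e \<in> E. u e = i} h \<sigma>))\<rparr>"

definition dep_sum_counit :: "'e set \<Rightarrow> ('e \<Rightarrow> 'i) \<Rightarrow> ('x, 'i) over \<Rightarrow> 'x \<times> 'e \<Rightarrow> 'x" where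
  "dep_sum_counit E u X = restrict fst (tot (fobj (pull E u) X))"

definition dep_prod_counit ::
  "'e set \<Rightarrow> 'i set \<Rightarrow> ('e \<Rightarrow> 'i) \<Rightarrow> ('x, 'e) over \<Rightarrow> ('i \<times> ('e \<Rightarrow> 'x)) \<times> 'e \<Rightarrow> 'x" where
  "dep_prod_counit E I u X =
     restrict (\<lambda>((i, \<sigma>), e). \<sigma> e) (tot (fobj (pull E u) (fobj (dep_prod E I u) X)))"

lemma slice_homD:
  assumes "h \<in> slice_hom X Y"
  shows "h \<in> tot X \<rightarrow>\<^sub>E tot Y" "x \<in> tot X \<Longrightarrow> h x \<in> tot Y"
    "x \<in> tot X \<Longrightarrow> proj Y (h x) = proj X x" "x \<notin> tot X \<Longrightarrow> h x = undefined"
proof -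
  have "h \<in> tot X \<rightarrow>\<^sub>E tot Y" and c: "compose (tot X) (proj Y) h = proj X"
    using assms by (auto simp: slice_hom_def)
  then show "h \<in> tot X \<rightarrow>\<^sub>E tot Y" "x \<in> tot X \<Longrightarrow> h x \<in> tot Y"
    "x \<notin> tot X \<Longrightarrow> h x = undefined" by auto
  show "x \<in> tot X \<Longrightarrow> proj Y (h x) = proj X x"
    using fun_cong[OF c, of x] by (simp add: compose_def)
qed

lemma sliceD:
  assumes "X \<in> slice I"
  shows "x \<in> tot X \<Longrightarrow> proj X x \<in> I" "x \<notin> tot X \<Longrightarrow> proj X x = undefined"
  using assms by (auto simp: slice_def)

lemma slice_homI:
  assumes "X \<in> slice I" "h \<in> tot X \<rightarrow>\<^sub>E tot Y" "\<And>x. x \<in> tot X \<Longrightarrow> proj Y (h x) = proj X x"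
  shows "h \<in> slice_hom X Y"
  using assms by (auto simp: slice_hom_def compose_def fun_eq_iff dest: sliceD)

lemma slice_comp_in_hom:
  assumes "X \<in> slice I" "h \<in> slice_hom X Y" "k \<in> slice_hom Y Z"
  shows "slice_comp X k h \<in> slice_hom X Z"
  using slice_homD[OF assms(2)] slice_homD[OF assms(3)]
  by (intro slice_homI[OF assms(1)]) (auto simp: slice_comp_def compose_def)

lemma functor_comp_functor:
  assumes "slice_functor I J F" "slice_functor J K G"
  shows "slice_functor I K (G \<circ>\<^sub>F F)"
  using assms by (simp add: slice_functor_def functor_comp_def)

lemma pull_sel:
  "tot (fobj (pull E u) X) = {(x, e). x \<in> tot X \<and> e \<in> E \<and> proj X x = u e}"
  "proj (fobj (pull E u) X) = restrict snd {(x, e). x \<in> tot X \<and> e \<in> E \<and> proj X x = u e}"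
  "fmap (pull E u) X Y h =
     (\<lambda>(x, e)\<in>{(x, e). x \<in> tot X \<and> e \<in> E \<and> proj X x = u e}. (h x, e))"
  by (simp_all add: pull_def Let_def)

lemma dep_sum_sel:
  "tot (fobj (dep_sum u) X) = tot X"
  "proj (fobj (dep_sum u) X) = compose (tot X) u (proj X)"
  "fmap (dep_sum u) X Y h = h"
  by (simp_all add: dep_sum_def)

lemma dep_prod_sel:
  "tot (fobj (dep_prod E I u) X) = Sigma I (sections E u X)"
  "proj (fobj (dep_prod E I u) X) = restrict fst (Sigma I (sections E u X))"
  "fmap (dep_prod E I u) X Y h =
     (\<lambda>(i, \<sigma>)\<in>Sigma I (sections E u X). (i, compose {e \<in> E. u e = i} h \<sigma>))"
  by (simp_all add: dep_prod_def Let_def)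

lemma pull_slice: "fobj (pull E u) X \<in> slice E"
  by (auto simp: slice_def pull_sel)

lemma dep_sum_slice: "u \<in> E \<rightarrow> I \<Longrightarrow> X \<in> slice E \<Longrightarrow> fobj (dep_sum u) X \<in> slice I"
  by (auto simp: slice_def dep_sum_sel compose_def)

lemma dep_prod_slice: "fobj (dep_prod E I u) X \<in> slice I"
  by (auto simp: slice_def dep_prod_sel)

lemma pull_functor:
  fixes u :: "'e \<Rightarrow> 'i"
  shows "slice_functor I E (pull E u)"
  unfolding slice_functor_def
proof (intro conjI ballI)
  fix X Y :: "('x, 'i) over" and h assume XY: "X \<in> slice I" "Y \<in> slice I" and h: "h \<in> slice_hom X Y"
  show "fmap (pull E u) X Y h \<in> slice_hom (fobj (pull E u) X) (fobj (pull E u) Y)"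
    by (rule slice_homI[OF pull_slice]) (auto simp: pull_sel slice_homD[OF h])
next
  fix X Y Z :: "('x, 'i) over" and h k
  assume h: "h \<in> slice_hom X Y" and k: "k \<in> slice_hom Y Z"
  show "fmap (pull E u) X Z (slice_comp X k h) = slice_comp (fobj (pull E u) X)
       (fmap (pull E u) Y Z k) (fmap (pull E u) X Y h)"
    by (auto simp: pull_sel slice_comp_def compose_def fun_eq_iff slice_homD[OF h] slice_homD[OF k])
qed (auto simp: pull_slice pull_sel slice_id_def fun_eq_iff)

lemma dep_sum_functor:
  fixes u :: "'e \<Rightarrow> 'i"
  assumes u: "u \<in> E \<rightarrow> I"
  shows "slice_functor E I (dep_sum u)"
  unfolding slice_functor_def
proof (intro conjI ballI)
  fix X Y :: "('x, 'e) over" and h assume X: "X \<in> slice E" and h: "h \<in> slice_hom X Y"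
  show "fmap (dep_sum u) X Y h \<in> slice_hom (fobj (dep_sum u) X) (fobj (dep_sum u) Y)"
    by (rule slice_homI[OF dep_sum_slice[OF u X]])
      (use slice_homD[OF h] in \<open>auto simp: dep_sum_sel compose_def\<close>)
qed (auto simp: dep_sum_slice[OF u] dep_sum_sel slice_id_def slice_comp_def)

lemma sections_map:
  assumes "h \<in> slice_hom X Y" "\<sigma> \<in> sections E u X i"
  shows "compose {e \<in> E. u e = i} h \<sigma> \<in> sections E u Y i"
  using assms slice_homD[OF assms(1)] by (auto simp: sections_def compose_def PiE_def Pi_def)

lemma dep_prod_functor:
  fixes u :: "'e \<Rightarrow> 'i"
  shows "slice_functor E I (dep_prod E I u)"
  unfolding slice_functor_def
proof (intro conjI ballI)
  fix X Y :: "('x, 'e) over" and h assume h: "h \<in> slice_hom X Y"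
  show "fmap (dep_prod E I u) X Y h \<in> slice_hom (fobj (dep_prod E I u) X) (fobj (dep_prod E I u) Y)"
    by (rule slice_homI[OF dep_prod_slice]) (auto simp: dep_prod_sel sections_map[OF h])
next
  fix X Y Z :: "('x, 'e) over" and h k
  assume h: "h \<in> slice_hom X Y" and k: "k \<in> slice_hom Y Z"
  show "fmap (dep_prod E I u) X Z (slice_comp X k h) = slice_comp (fobj (dep_prod E I u) X)
       (fmap (dep_prod E I u) Y Z k) (fmap (dep_prod E I u) X Y h)"
    using sections_map[OF h, of _ E u]
    by (auto simp: dep_prod_sel slice_comp_def fun_eq_iff) 
      (auto simp: compose_def fun_eq_iff sections_def)
next
  fix X :: "('x, 'e) over"
  show "fmap (dep_prod E I u) X X (slice_id X) = slice_id (fobj (dep_prod E I u) X)"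
    by (auto simp: dep_prod_sel slice_id_def fun_eq_iff)
      (auto simp: compose_def fun_eq_iff sections_def PiE_def extensional_def)
qed (rule dep_prod_slice)

text \<open>
  The adjunctions \<open>u\<^sub>! \<stileturn> u\<^sup>* \<stileturn> u\<^sub>*\<close>, as natural and universal counits
  \<open>u\<^sub>! u\<^sup>* \<rightarrow> id\<close> and \<open>u\<^sup>* u\<^sub>* \<rightarrow> id\<close>. In the universal properties the map \<open>k\<close> changes the
  universe, so \<open>u\<^sub>! k = k\<close> and \<open>u\<^sup>* k\<close> are written out instead of using \<open>fmap\<close>.
\<close>

lemma dep_sum_counit_natural:
  fixes u :: "'e \<Rightarrow> 'i"
  assumes u: "u \<in> E \<rightarrow> I"
  shows "natural_transformation I (dep_sum u \<circ>\<^sub>F pull E u)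
           \<lparr>fobj = \<lambda>X. X, fmap = \<lambda>X Y h. h\<rparr> (dep_sum_counit E u)"
  unfolding natural_transformation_def
proof (intro conjI ballI)
  fix X :: "('x, 'i) over" assume X: "X \<in> slice I"
  show "dep_sum_counit E u X \<in> slice_hom (fobj (dep_sum u \<circ>\<^sub>F pull E u) X)
          (fobj \<lparr>fobj = \<lambda>X. X, fmap = \<lambda>X Y h. h\<rparr> X)"
    by (simp add: functor_comp_def, rule slice_homI[OF dep_sum_slice[OF u pull_slice]])
      (auto simp: dep_sum_counit_def pull_sel dep_sum_sel compose_def)
next
  fix X Y :: "('x, 'i) over" and h assume h: "h \<in> slice_hom X Y"
  show "slice_comp (fobj (dep_sum u \<circ>\<^sub>F pull E u) X) (dep_sum_counit E u Y)
          (fmap (dep_sum u \<circ>\<^sub>F pull E u) X Y h) =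
        slice_comp (fobj (dep_sum u \<circ>\<^sub>F pull E u) X)
          (fmap \<lparr>fobj = \<lambda>X. X, fmap = \<lambda>X Y h. h\<rparr> X Y h) (dep_sum_counit E u X)"
    by (auto simp: functor_comp_def dep_sum_counit_def pull_sel dep_sum_sel slice_comp_def
        compose_def fun_eq_iff slice_homD[OF h])
qed

lemma dep_sum_left_adjoint:
  assumes u: "u \<in> E \<rightarrow> I" and X: "X \<in> slice E" and Y: "Y \<in> slice I"
    and h: "h \<in> slice_hom (fobj (dep_sum u) X) Y"
  shows "\<exists>!k. k \<in> slice_hom X (fobj (pull E u) Y) \<and>
           slice_comp (fobj (dep_sum u) X) (dep_sum_counit E u Y) k = h"
proof (rule ex1I)
  let ?k = "\<lambda>x\<in>tot X. (h x, proj X x)"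
  have hD: "h x \<in> tot Y" "proj Y (h x) = u (proj X x)" if "x \<in> tot X" for x
    using slice_homD(2,3)[OF h, of x] that by (auto simp: dep_sum_sel compose_def)
  have hu: "h x = undefined" if "x \<notin> tot X" for x
    using slice_homD(4)[OF h, of x] that by (auto simp: dep_sum_sel)
  have "?k \<in> slice_hom X (fobj (pull E u) Y)"
    by (rule slice_homI[OF X]) (auto simp: pull_sel hD sliceD(1)[OF X])
  moreover have "slice_comp (fobj (dep_sum u) X) (dep_sum_counit E u Y) ?k = h"
    by (auto simp: slice_comp_def dep_sum_counit_def dep_sum_sel compose_def fun_eq_iff pull_sel hD
        hu sliceD(1)[OF X])
  ultimately show "?k \<in> slice_hom X (fobj (pull E u) Y) \<and>
           slice_comp (fobj (dep_sum u) X) (dep_sum_counit E u Y) ?k = h" by blast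
  fix k assume k: "k \<in> slice_hom X (fobj (pull E u) Y) \<and>
           slice_comp (fobj (dep_sum u) X) (dep_sum_counit E u Y) k = h"
  show "k = ?k"
  proof
    fix x
    show "k x = ?k x"
    proof (cases "x \<in> tot X")
      case True
      have "k x \<in> tot (fobj (pull E u) Y)" "proj (fobj (pull E u) Y) (k x) = proj X x"
        using k True by (auto dest: slice_homD)
      moreover have "dep_sum_counit E u Y (k x) = h x"
        using k True by (auto simp: slice_comp_def dep_sum_sel compose_def)
      ultimately show ?thesis using True by (auto simp: dep_sum_counit_def pull_sel)
    next
      case False
      then show ?thesis using k by (auto dest: slice_homD(4))
    qed
  qed
qed

lemma dep_prod_counit_natural:
  fixes u :: "'e \<Rightarrow> 'i"
  assumes u: "u \<in> E \<rightarrow> I"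
  shows "natural_transformation E (pull E u \<circ>\<^sub>F dep_prod E I u)
           \<lparr>fobj = \<lambda>X. X, fmap = \<lambda>X Y h. h\<rparr> (dep_prod_counit E I u)"
  unfolding natural_transformation_def
proof (intro conjI ballI)
  fix X :: "('x, 'e) over" assume X: "X \<in> slice E"
  show "dep_prod_counit E I u X \<in> slice_hom (fobj (pull E u \<circ>\<^sub>F dep_prod E I u) X)
          (fobj \<lparr>fobj = \<lambda>X. X, fmap = \<lambda>X Y h. h\<rparr> X)"
    by (simp add: functor_comp_def, rule slice_homI[OF pull_slice])
      (auto simp: dep_prod_counit_def pull_sel dep_prod_sel sections_def)
next
  fix X Y :: "('x, 'e) over" and h assume h: "h \<in> slice_hom X Y"
  show "slice_comp (fobj (pull E u \<circ>\<^sub>F dep_prod E I u) X) (dep_prod_counit E I u Y)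
          (fmap (pull E u \<circ>\<^sub>F dep_prod E I u) X Y h) =
        slice_comp (fobj (pull E u \<circ>\<^sub>F dep_prod E I u) X)
          (fmap \<lparr>fobj = \<lambda>X. X, fmap = \<lambda>X Y h. h\<rparr> X Y h) (dep_prod_counit E I u X)"
    using sections_map[OF h, of _ E u]
    by (auto simp: functor_comp_def dep_prod_counit_def pull_sel dep_prod_sel slice_comp_def
        fun_eq_iff) (auto simp: compose_def dep_prod_sel pull_sel)
qed

lemma dep_prod_right_adjoint:
  assumes u: "u \<in> E \<rightarrow> I" and X: "X \<in> slice I" and Y: "Y \<in> slice E"
    and h: "h \<in> slice_hom (fobj (pull E u) X) Y"
  shows "\<exists>!k. k \<in> slice_hom X (fobj (dep_prod E I u) Y) \<and>
           slice_comp (fobj (pull E u) X) (dep_prod_counit E I u Y)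
             (\<lambda>(x, e)\<in>tot (fobj (pull E u) X). (k x, e)) = h"
proof (rule ex1I)
  let ?\<sigma> = "\<lambda>x. \<lambda>e\<in>{e \<in> E. u e = proj X x}. h (x, e)"
  let ?k = "\<lambda>x\<in>tot X. (proj X x, ?\<sigma> x)"
  have hD: "h (x, e) \<in> tot Y" "proj Y (h (x, e)) = e"
    if "x \<in> tot X" "e \<in> E" "u e = proj X x" for x e
    using slice_homD(2,3)[OF h, of "(x, e)"] that by (auto simp: pull_sel)
  have hu: "h (x, e) = undefined" if "\<not> (x \<in> tot X \<and> e \<in> E \<and> u e = proj X x)" for x e
    using slice_homD(4)[OF h, of "(x, e)"] that by (auto simp: pull_sel)
  have \<sigma>: "?\<sigma> x \<in> sections E u Y (proj X x)" if "x \<in> tot X" for x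
    using that hD by (auto simp: sections_def)
  have \<sigma>': "(\<lambda>e\<in>{e \<in> E. u e = j}. h (x, e)) \<in> sections E u Y j"
    if "x \<in> tot X" "proj X x = j" for x j
    using \<sigma>[OF that(1)] that(2) by simp
  have "?k \<in> slice_hom X (fobj (dep_prod E I u) Y)"
    by (rule slice_homI[OF X]) (auto simp: dep_prod_sel \<sigma> sliceD(1)[OF X])
  moreover have "slice_comp (fobj (pull E u) X) (dep_prod_counit E I u Y)
             (\<lambda>(x, e)\<in>tot (fobj (pull E u) X). (?k x, e)) = h"
    using \<sigma>' hu sliceD(1)[OF X] funcset_mem[OF u]
    by (auto simp: slice_comp_def dep_prod_counit_def compose_def fun_eq_iff pull_sel dep_prod_sel)
  ultimately show "?k \<in> slice_hom X (fobj (dep_prod E I u) Y) \<and>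
           slice_comp (fobj (pull E u) X) (dep_prod_counit E I u Y)
             (\<lambda>(x, e)\<in>tot (fobj (pull E u) X). (?k x, e)) = h" by blast
  fix k assume k: "k \<in> slice_hom X (fobj (dep_prod E I u) Y) \<and>
           slice_comp (fobj (pull E u) X) (dep_prod_counit E I u Y)
             (\<lambda>(x, e)\<in>tot (fobj (pull E u) X). (k x, e)) = h"
  show "k = ?k"
  proof
    fix x
    show "k x = ?k x"
    proof (cases "x \<in> tot X")
      case True
      obtain i \<sigma> where kx: "k x = (i, \<sigma>)" by (cases "k x")
      have m: "k x \<in> tot (fobj (dep_prod E I u) Y)" and "proj (fobj (dep_prod E I u) Y) (k x) = proj X x"
        using k True by (auto dest: slice_homD)
      then have i: "i = proj X x" and s: "\<sigma> \<in> sections E u Y i" "i \<in> I" using kx by (auto simp: dep_prod_sel)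
      have "\<sigma> e = h (x, e)" if e: "e \<in> E" "u e = proj X x" for e
      proof -
        have "slice_comp (fobj (pull E u) X) (dep_prod_counit E I u Y)
             (\<lambda>(x, e)\<in>tot (fobj (pull E u) X). (k x, e)) (x, e) = \<sigma> e"
          using True e kx i s
          by (auto simp: slice_comp_def dep_prod_counit_def compose_def pull_sel dep_prod_sel)
        then show ?thesis using k by simp
      qed
      moreover have "\<sigma> e = undefined" if "\<not> (e \<in> E \<and> u e = proj X x)" for e
        using s i that by (auto simp: sections_def PiE_def extensional_def)
      ultimately have "\<sigma> = ?\<sigma> x" by (auto simp: fun_eq_iff)
      then show ?thesis using True kx i by simp
    next
      case False
      then show ?thesis using k by (auto dest: slice_homD(4))
    qed
  qed
qed

section \<open>Polynomial functors\<close>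

definition polynomial_diagram ::
  "'i set \<Rightarrow> 'e set \<Rightarrow> 'a set \<Rightarrow> ('e \<Rightarrow> 'i) \<Rightarrow> ('e \<Rightarrow> 'a) \<Rightarrow> ('a \<Rightarrow> 'i) \<Rightarrow> bool" where
  "polynomial_diagram I E A s p t \<longleftrightarrow> s \<in> E \<rightarrow> I \<and> p \<in> E \<rightarrow> A \<and> t \<in> A \<rightarrow> I"

definition poly_functor ::
  "'e set \<Rightarrow> 'a set \<Rightarrow> ('e \<Rightarrow> 'i) \<Rightarrow> ('e \<Rightarrow> 'a) \<Rightarrow> ('a \<Rightarrow> 'i) \<Rightarrow>
   ('x, 'i, 'a \<times> ('e \<Rightarrow> 'x \<times> 'e), 'i) slice_fun" where
  "poly_functor E A s p t = dep_sum t \<circ>\<^sub>F dep_prod E A p \<circ>\<^sub>F pull E s"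

lemma poly_functor_functor:
  "polynomial_diagram I E A s p t \<Longrightarrow> slice_functor I I (poly_functor E A s p t)"
  unfolding poly_functor_def polynomial_diagram_def
  by (blast intro: functor_comp_functor pull_functor dep_prod_functor dep_sum_functor)

text \<open>
  The sets \<open>I\<close>, \<open>E\<close>, \<open>A\<close> of a polynomial diagram are objects of the same category \<open>Set('u)\<close> on
  whose slice the functor is defined.
\<close>

definition polynomial_functor :: "'u set \<Rightarrow> ('u, 'u, 'v, 'u) slice_fun \<Rightarrow> bool" where
  "polynomial_functor I P \<longleftrightarrow>
     slice_functor I I P \<and>
     (\<exists>(E :: 'u set) (A :: 'u set) s p t. polynomial_diagram I E A s p t \<and>
        isomorphic_functors I P (poly_functor E A s p t))"

end

(* Every element x of P X for a polynomial functor P is of the form P f g with g generic: g has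
   unique fillers for squares P u y = P v g. Given P h x = P h x' and \<tau> x = \<tau> x', write x = P f g
   with g generic; then x' = P f' g for some f'. Write \<tau> g = R k g' with g' generic for R. Weak
   cartesianness at k lifts g along P k, so by genericity of g the map k has a section m. Since
   R (f k) g' = \<tau> x = \<tau> x' = R (f' k) g', genericity of g' gives f k = f' k, so f = f k m = f' k m = f'. *)

theory Submission
  imports Defs
begin

section \<open>Generic elements and functors that have enough of them\<close>

text \<open>Together the two clauses say that \<open>(G, g)\<close> is initial in its connected
  component of the category of elements of \<open>F\<close>. Uniqueness mentions neither
  \<open>u\<close> nor \<open>v\<close>, so that it can be used directly to cancel
  \<open>g\<close>.\<close>

definition generic ::
  "'i set \<Rightarrow> ('x, 'i, 'y, 'j) slice_fun \<Rightarrow> ('x, 'i) over \<Rightarrow> 'y \<Rightarrow> bool" where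
  "generic I F G g \<longleftrightarrow> G \<in> slice I \<and> g \<in> tot (fobj F G) \<and>
     (\<forall>Y\<in>slice I. \<forall>Z\<in>slice I. \<forall>u\<in>slice_hom Y Z. \<forall>v\<in>slice_hom G Z. \<forall>y\<in>tot (fobj F Y).
        fmap F Y Z u y = fmap F G Z v g \<longrightarrow>
        (\<exists>w\<in>slice_hom G Y. fmap F G Y w g = y \<and> slice_comp G u w = v)) \<and>
     (\<forall>Y\<in>slice I. \<forall>w\<in>slice_hom G Y. \<forall>w'\<in>slice_hom G Y.
        fmap F G Y w g = fmap F G Y w' g \<longrightarrow> w = w')"

text \<open>Equivalently, every connected component of the category of elements of \<open>F\<close>
  has an initial object. This is the form in which polynomiality enters the main argument.\<close>

definition enough_generics :: "'i set \<Rightarrow> ('x, 'i, 'y, 'j) slice_fun \<Rightarrow> bool" where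
  "enough_generics I F \<longleftrightarrow> (\<forall>X\<in>slice I. \<forall>x\<in>tot (fobj F X).
     \<exists>G g. generic I F G g \<and> (\<exists>f\<in>slice_hom G X. fmap F G X f g = x))"

lemma genericD:
  assumes "generic I F G g"
  shows "G \<in> slice I" "g \<in> tot (fobj F G)"
    "Y \<in> slice I \<Longrightarrow> w \<in> slice_hom G Y \<Longrightarrow> w' \<in> slice_hom G Y \<Longrightarrow>
       fmap F G Y w g = fmap F G Y w' g \<Longrightarrow> w = w'"
  using assms by (auto simp: generic_def)

lemma generic_filler:
  assumes "generic I F G g" "Y \<in> slice I" "Z \<in> slice I" "u \<in> slice_hom Y Z" "v \<in> slice_hom G Z"
    "y \<in> tot (fobj F Y)" "fmap F Y Z u y = fmap F G Z v g"
  obtains w where "w \<in> slice_hom G Y" "fmap F G Y w g = y" "slice_comp G u w = v"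
  using assms unfolding generic_def by blast

lemma enough_genericsE:
  assumes "enough_generics I F" "X \<in> slice I" "x \<in> tot (fobj F X)"
  obtains G g f where "generic I F G g" "f \<in> slice_hom G X" "fmap F G X f g = x"
  using assms unfolding enough_generics_def by blast

section \<open>Slice, functor and naturality laws on elements\<close>

lemma slice_id_in_hom: "X \<in> slice I \<Longrightarrow> slice_id X \<in> slice_hom X X"
  by (rule slice_homI) (auto simp: slice_id_def)

lemma slice_comp_id: "h \<in> slice_hom X Y \<Longrightarrow> slice_comp X h (slice_id X) = h"
  by (auto simp: slice_comp_def slice_id_def compose_def fun_eq_iff dest: slice_homD(4))

lemma slice_comp_assoc:
  assumes "f \<in> slice_hom W X"
  shows "slice_comp W h (slice_comp W g f) = slice_comp W (slice_comp X h g) f"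
  using slice_homD(2)[OF assms] by (auto simp: slice_comp_def compose_def fun_eq_iff)

lemma slice_comp_apply: "x \<in> tot X \<Longrightarrow> slice_comp X g f x = g (f x)"
  by (simp add: slice_comp_def compose_def)

lemma fmap_tot:
  assumes "slice_functor I J F" "X \<in> slice I" "Y \<in> slice I" "h \<in> slice_hom X Y" "x \<in> tot (fobj F X)"
  shows "fmap F X Y h x \<in> tot (fobj F Y)"
  using assms unfolding slice_functor_def by (meson slice_homD(2))

lemma fmap_comp:
  assumes "slice_functor I J F" "X \<in> slice I" "Y \<in> slice I" "Z \<in> slice I"
    "h \<in> slice_hom X Y" "k \<in> slice_hom Y Z" "x \<in> tot (fobj F X)"
  shows "fmap F X Z (slice_comp X k h) x = fmap F Y Z k (fmap F X Y h x)"
  using assms unfolding slice_functor_def by (simp add: slice_comp_apply)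

lemma fmap_id:
  assumes "slice_functor I J F" "X \<in> slice I" "x \<in> tot (fobj F X)"
  shows "fmap F X X (slice_id X) x = x"
  using assms unfolding slice_functor_def by (simp add: slice_id_def)

lemma natural_transformation_tot:
  assumes "natural_transformation I F G \<tau>" "X \<in> slice I" "x \<in> tot (fobj F X)"
  shows "\<tau> X x \<in> tot (fobj G X)"
  using assms unfolding natural_transformation_def by (meson slice_homD(2))

lemma natural_transformation_apply:
  assumes "natural_transformation I F G \<tau>" "X \<in> slice I" "Y \<in> slice I" "h \<in> slice_hom X Y"
    "x \<in> tot (fobj F X)"
  shows "\<tau> Y (fmap F X Y h x) = fmap G X Y h (\<tau> X x)"
proof -
  have "slice_comp (fobj F X) (\<tau> Y) (fmap F X Y h) = slice_comp (fobj F X) (fmap G X Y h) (\<tau> X)"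
    using assms unfolding natural_transformation_def by blast
  from fun_cong[OF this, of x] show ?thesis using assms(5) by (simp add: slice_comp_apply)
qed

lemma slice_iso_bij_betw:
  assumes "slice_iso X Y h"
  shows "bij_betw h (tot X) (tot Y)"
proof -
  obtain k where k: "k \<in> slice_hom Y X" "slice_comp X k h = slice_id X" "slice_comp Y h k = slice_id Y"
    and h: "h \<in> slice_hom X Y" using assms by (auto simp: slice_iso_def)
  have "k (h x) = x" if "x \<in> tot X" for x
    using fun_cong[OF k(2), of x] that by (simp add: slice_comp_apply slice_id_def)
  moreover have "h (k y) = y" if "y \<in> tot Y" for y
    using fun_cong[OF k(3), of y] that by (simp add: slice_comp_apply slice_id_def)
  ultimately show ?thesis
    using slice_homD(2)[OF h] slice_homD(2)[OF k(1)] by (intro bij_betwI[of _ _ _ k]) auto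
qed

text \<open>Equations between elements of \<open>F\<close> pass to \<open>H\<close> by naturality of
  \<open>\<alpha>\<close> and come back by injectivity of its components, so the preimage of a
  generic element is generic. The universes of \<open>F\<close> and \<open>H\<close> may differ, as
  those of \<open>P\<close> and its explicit polynomial model do.\<close>

lemma enough_generics_isomorphic:
  fixes F :: "('x, 'i, 'y, 'i) slice_fun" and H :: "('x, 'i, 'z, 'i) slice_fun"
  assumes F: "slice_functor I J F" and iso: "isomorphic_functors I F H" and H: "enough_generics I H"
  shows "enough_generics I F"
  unfolding enough_generics_def
proof (intro ballI)
  obtain \<alpha> where \<alpha>: "natural_transformation I F H \<alpha>"
    and bij: "\<And>X. X \<in> slice I \<Longrightarrow> bij_betw (\<alpha> X) (tot (fobj F X)) (tot (fobj H X))"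
    using iso slice_iso_bij_betw unfolding isomorphic_functors_def by blast
  note nat = natural_transformation_apply[OF \<alpha>]
  note inj = bij_betw_imp_inj_on[OF bij, THEN inj_onD]
  fix X :: "('x, 'i) over" and x assume X: "X \<in> slice I" and x: "x \<in> tot (fobj F X)"
  obtain G g f where gen: "generic I H G g" and f: "f \<in> slice_hom G X" "fmap H G X f g = \<alpha> X x"
    by (rule enough_genericsE[OF H X natural_transformation_tot[OF \<alpha> X x]])
  note G = genericD[OF gen]
  obtain g' where g': "g' \<in> tot (fobj F G)" "\<alpha> G g' = g"
    using bij_betw_imp_surj_on[OF bij[OF G(1)]] G(2) by (metis imageE)
  have fil: "\<exists>w\<in>slice_hom G Y. fmap F G Y w g' = y \<and> slice_comp G u w = v"
    if Y: "Y \<in> slice I" "Z \<in> slice I" and u: "u \<in> slice_hom Y Z" and v: "v \<in> slice_hom G Z"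
      and y: "y \<in> tot (fobj F Y)" and eq: "fmap F Y Z u y = fmap F G Z v g'" for Y Z u v y
  proof -
    have "fmap H Y Z u (\<alpha> Y y) = fmap H G Z v g"
      using nat[OF Y u y] nat[OF G(1) Y(2) v g'(1)] eq g'(2) by simp
    from generic_filler[OF gen Y u v natural_transformation_tot[OF \<alpha> Y(1) y] this]
    obtain w where w: "w \<in> slice_hom G Y" "fmap H G Y w g = \<alpha> Y y" "slice_comp G u w = v" .
    have "fmap F G Y w g' = y"
      by (rule inj[OF Y(1) _ fmap_tot[OF F G(1) Y(1) w(1) g'(1)] y])
        (simp add: nat[OF G(1) Y(1) w(1) g'(1)] g'(2) w(2))
    with w show ?thesis by blast
  qed
  have uni: "w = w'" if Y: "Y \<in> slice I" and w: "w \<in> slice_hom G Y" "w' \<in> slice_hom G Y"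
      and eq: "fmap F G Y w g' = fmap F G Y w' g'" for Y w w'
  proof (rule G(3)[OF Y w])
    show "fmap H G Y w g = fmap H G Y w' g"
      using nat[OF G(1) Y w(1) g'(1)] nat[OF G(1) Y w(2) g'(1)] eq g'(2) by simp
  qed
  have gen': "generic I F G g'"
    unfolding generic_def using G(1) g'(1) fil uni by blast
  have "fmap F G X f g' = x"
    by (rule inj[OF X _ fmap_tot[OF F G(1) X f(1) g'(1)] x])
      (simp add: nat[OF G(1) X f(1) g'(1)] g'(2) f(2))
  with gen' f(1) show "\<exists>G g. generic I F G g \<and> (\<exists>f\<in>slice_hom G X. fmap F G X f g = x)" by blast
qed

section \<open>Generic elements of polynomial functors\<close>

text \<open>The second component of \<open>\<sigma> e\<close> repeats \<open>e\<close> because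
  \<open>pull\<close> represents the points of a pullback as pairs; the information lies in
  \<open>a\<close> and \<open>fst (\<sigma> e)\<close>.\<close>

lemma poly_functor_tot:
  "tot (fobj (poly_functor E A s p t) X) = {(a, \<sigma>). a \<in> A \<and>
     \<sigma> \<in> extensional {e \<in> E. p e = a} \<and>
     (\<forall>e\<in>E. p e = a \<longrightarrow> fst (\<sigma> e) \<in> tot X \<and> proj X (fst (\<sigma> e)) = s e \<and> snd (\<sigma> e) = e)}"
  by (auto simp: poly_functor_def functor_comp_def dep_sum_sel dep_prod_sel pull_sel sections_def
      PiE_def Pi_def case_prod_beta)

lemma poly_functor_fmap:
  assumes "(a, \<sigma>) \<in> tot (fobj (poly_functor E A s p t) X)"
  shows "fmap (poly_functor E A s p t) X Y h (a, \<sigma>) = (a, \<lambda>e\<in>{e \<in> E. p e = a}. (h (fst (\<sigma> e)), e))"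
proof -
  have "(a, \<sigma>) \<in> Sigma A (sections E p (fobj (pull E s) X))"
    using assms by (simp add: poly_functor_def functor_comp_def dep_sum_sel dep_prod_sel)
  moreover have "snd (\<sigma> e) = e" "fst (\<sigma> e) \<in> tot X" "proj X (fst (\<sigma> e)) = s e"
    if "e \<in> E" "p e = a" for e
    using assms that unfolding poly_functor_tot by auto
  ultimately show ?thesis
    by (auto simp: poly_functor_def functor_comp_def dep_sum_sel dep_prod_sel pull_sel compose_def
        fun_eq_iff case_prod_beta)
qed

text \<open>The fibre of \<open>p\<close> at \<open>a\<close>, as an object over \<open>I\<close> via \<open>s\<close>, represents the summand at \<open>a\<close>;
  the section \<open>e \<mapsto> (e, e)\<close> corresponds to the identity under this representation.\<close>

lemma poly_functor_enough_generics:
  fixes E :: "'x set" and s :: "'x \<Rightarrow> 'i"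
  assumes s: "s \<in> E \<rightarrow> I"
  shows "enough_generics I (poly_functor E A s p t :: ('x, 'i, _, 'i) slice_fun)"
  unfolding enough_generics_def
proof (intro ballI)
  let ?F = "poly_functor E A s p t :: ('x, 'i, _, 'i) slice_fun"
  fix X :: "('x, 'i) over" and x assume X: "X \<in> slice I" and x: "x \<in> tot (fobj ?F X)"
  obtain a \<sigma> where xa: "x = (a, \<sigma>)" by (cases x)
  define B where "B = {e \<in> E. p e = a}"
  define G where "G = \<lparr>tot = B, proj = restrict s B\<rparr>"
  define g where "g = (a, \<lambda>e\<in>B. (e, e))"
  have a: "a \<in> A" using x xa by (auto simp: poly_functor_tot)
  have G: "G \<in> slice I" using s by (auto simp: slice_def G_def B_def)
  have g: "g \<in> tot (fobj ?F G)" using a by (auto simp: g_def poly_functor_tot G_def B_def)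
  \<comment> \<open>The image of \<open>g\<close> under \<open>w\<close> records the whole graph of
    \<open>w\<close> on \<open>B\<close>, which gives uniqueness below.\<close>
  have map_g: "fmap ?F G Y w g = (a, \<lambda>e\<in>B. (w e, e))" for Y w
    using poly_functor_fmap[OF g[unfolded g_def], of Y w]
    by (simp add: g_def B_def fun_eq_iff)
  \<comment> \<open>The other half of representability: any element with first component
    \<open>a\<close> is the image of \<open>g\<close> under the first components of its
    section.\<close>
  have hom: "restrict (fst \<circ> \<rho>) B \<in> slice_hom G Y" "fmap ?F G Y (restrict (fst \<circ> \<rho>) B) g = (a, \<rho>)"
    if "(a, \<rho>) \<in> tot (fobj ?F Y)" for Y \<rho>
  proof -
    have r: "fst (\<rho> e) \<in> tot Y" "proj Y (fst (\<rho> e)) = s e" "snd (\<rho> e) = e" if "e \<in> B" for e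
      using \<open>(a, \<rho>) \<in> _\<close> that unfolding poly_functor_tot by (auto simp: B_def)
    show "restrict (fst \<circ> \<rho>) B \<in> slice_hom G Y"
      by (rule slice_homI[OF G]) (auto simp: G_def r(1,2))
    have "\<rho> \<in> extensional B" using that unfolding poly_functor_tot by (auto simp: B_def)
    then show "fmap ?F G Y (restrict (fst \<circ> \<rho>) B) g = (a, \<rho>)"
      using r(3) by (auto simp: map_g fun_eq_iff extensional_def prod_eq_iff)
  qed
  have fil: "\<exists>w\<in>slice_hom G Y. fmap ?F G Y w g = y \<and> slice_comp G u w = v"
    if v: "v \<in> slice_hom G Z" and y: "y \<in> tot (fobj ?F Y)"
      and eq: "fmap ?F Y Z u y = fmap ?F G Z v g" for Y Z u v y
  proof -
    obtain b \<rho> where yb: "y = (b, \<rho>)" by (cases y)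
    \<comment> \<open>Since \<open>fmap\<close> preserves the first component, this equation forces
      \<open>b = a\<close>; its second component then says that \<open>u\<close> after
      \<open>fst (\<rho> e)\<close> is \<open>v\<close>.\<close>
    have eq': "(b, \<lambda>e\<in>{e \<in> E. p e = b}. (u (fst (\<rho> e)), e)) = (a, \<lambda>e\<in>B. (v e, e))"
      using eq unfolding yb map_g poly_functor_fmap[OF y[unfolded yb]] .
    then have b: "b = a" by simp
    have "u (fst (\<rho> e)) = v e" if "e \<in> B" for e
      using fun_cong[OF arg_cong[OF eq', of snd], of e] that b by (simp add: B_def)
    then have "slice_comp G u (restrict (fst \<circ> \<rho>) B) = v"
      using slice_homD(4)[OF v] by (auto simp: slice_comp_def compose_def G_def fun_eq_iff)
    then show ?thesis using hom[OF y[unfolded yb b]] yb b by blast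
  qed
  have uni: "w = w'" if w: "w \<in> slice_hom G Y" "w' \<in> slice_hom G Y"
      and eq: "fmap ?F G Y w g = fmap ?F G Y w' g" for Y w w'
  proof
    fix e
    show "w e = w' e"
    proof (cases "e \<in> B")
      case True
      have "(\<lambda>e\<in>B. (w e, e)) = (\<lambda>e\<in>B. (w' e, e))" using eq by (simp add: map_g)
      from fun_cong[OF this, of e] show ?thesis using True by simp
    next
      case False
      then show ?thesis using slice_homD(4)[OF w(1), of e] slice_homD(4)[OF w(2), of e]
        by (simp add: G_def)
    qed
  qed
  have "generic I ?F G g" unfolding generic_def using G g fil uni by blast
  then show "\<exists>G g. generic I ?F G g \<and> (\<exists>f\<in>slice_hom G X. fmap ?F G X f g = x)"
    using hom[OF x[unfolded xa]] xa by blast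
qed

lemma polynomial_functor_enough_generics:
  assumes "polynomial_functor I P"
  shows "enough_generics I P"
  using assms enough_generics_isomorphic poly_functor_enough_generics
  unfolding polynomial_functor_def polynomial_diagram_def by metis

section \<open>Weak pullbacks and pullbacks on elements\<close>

text \<open>A compatible pair of elements is a cone from a one-point object, and a factorization of
  that cone picks out the required \<open>w\<close>.\<close>

lemma weak_pullback_lift_element:
  fixes W :: "('x, 'i) over"
  assumes wp: "weak_pullback I W X Y Z p q f g" and x: "x \<in> tot X" and y: "y \<in> tot Y"
    and eq: "f x = g y"
  obtains w where "w \<in> tot W" "p w = x" "q w = y"
proof -
  have cs: "X \<in> slice I" "Y \<in> slice I" "f \<in> slice_hom X Z" "g \<in> slice_hom Y Z"
    using wp by (auto simp: weak_pullback_def commuting_square_def)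
  \<comment> \<open>The set \<open>{x}\<close> serves as the one-point set, lying over the common
    projection of \<open>x\<close> and \<open>y\<close>.\<close>
  define V :: "('x, 'i) over" where "V = \<lparr>tot = {x}, proj = (\<lambda>_\<in>{x}. proj X x)\<rparr>"
  have V: "V \<in> slice I" using sliceD(1)[OF cs(1) x] by (auto simp: slice_def V_def)
  have "proj X x = proj Y y"
    using slice_homD(3)[OF cs(3) x] slice_homD(3)[OF cs(4) y] eq by simp
  then have "(\<lambda>_\<in>{x}. x) \<in> slice_hom V X" "(\<lambda>_\<in>{x}. y) \<in> slice_hom V Y"
    using x y by (auto intro!: slice_homI[OF V]) (auto simp: V_def)
  moreover have "slice_comp V f (\<lambda>_\<in>{x}. x) = slice_comp V g (\<lambda>_\<in>{x}. y)"
    using eq by (auto simp: slice_comp_def compose_def V_def fun_eq_iff)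
  ultimately obtain h where h: "h \<in> slice_hom V W" "slice_comp V p h = (\<lambda>_\<in>{x}. x)"
      "slice_comp V q h = (\<lambda>_\<in>{x}. y)"
    using wp V unfolding weak_pullback_def by blast
  have xV: "x \<in> tot V" by (simp add: V_def)
  show ?thesis
    using that[of "h x"] slice_homD(2)[OF h(1) xV] fun_cong[OF h(2), of x] fun_cong[OF h(3), of x]
    by (simp add: slice_comp_apply[OF xV])
qed

text \<open>Factorizations exist already; joint injectivity makes two of them agree on
  \<open>tot V\<close>, and elsewhere both are \<open>undefined\<close>.\<close>

lemma weak_pullback_imp_pullback:
  fixes W :: "('x, 'i) over"
  assumes wp: "weak_pullback I W X Y Z p q f g"
    and inj: "\<And>w w'. w \<in> tot W \<Longrightarrow> w' \<in> tot W \<Longrightarrow> p w = p w' \<Longrightarrow> q w = q w' \<Longrightarrow> w = w'"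
  shows "pullback I W X Y Z p q f g"
proof -
  have "h = h'" if h: "h \<in> slice_hom V W" "h' \<in> slice_hom V W"
      and p: "slice_comp V p h = slice_comp V p h'" and q: "slice_comp V q h = slice_comp V q h'"
    for V :: "('x, 'i) over" and h h'
  proof
    fix v
    show "h v = h' v"
    proof (cases "v \<in> tot V")
      case True
      then show ?thesis
        using inj slice_homD(2)[OF h(1)] slice_homD(2)[OF h(2)] fun_cong[OF p, of v]
          fun_cong[OF q, of v] by (simp add: slice_comp_apply)
    next
      case False
      then show ?thesis using slice_homD(4)[OF h(1)] slice_homD(4)[OF h(2)] by simp
    qed
  qed
  then show ?thesis using wp unfolding weak_pullback_def pullback_def by (simp, metis)
qed

section \<open>Uniqueness of fillers for weakly cartesian transformations\<close>

lemma weakly_cartesian_jointly_injective: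
  assumes P: "slice_functor I J P" and R: "slice_functor I J R"
    and gP: "enough_generics I P" and gR: "enough_generics I R"
    and nt: "natural_transformation I P R \<tau>" and wc: "weakly_cartesian I J P R \<tau>"
    and X: "X \<in> slice I" and Y: "Y \<in> slice I" and h: "h \<in> slice_hom X Y"
    and x: "x \<in> tot (fobj P X)" and x': "x' \<in> tot (fobj P X)"
    and eqP: "fmap P X Y h x = fmap P X Y h x'" and eq\<tau>: "\<tau> X x = \<tau> X x'"
  shows "x = x'"
proof -
  note nat = natural_transformation_apply[OF nt]
  obtain G g f where gen: "generic I P G g" and f: "f \<in> slice_hom G X" "fmap P G X f g = x"
    by (rule enough_genericsE[OF gP X x])
  note G = genericD(1,2)[OF gen]
  have "fmap P X Y h x' = fmap P G Y (slice_comp G h f) g"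
    using fmap_comp[OF P G(1) X Y f(1) h G(2)] f(2) eqP by simp
  \<comment> \<open>The element \<open>x'\<close> is thus reached from the same \<open>g\<close> as
    \<open>x\<close>, and it remains to show \<open>f = f'\<close>.\<close>
  from generic_filler[OF gen X Y h slice_comp_in_hom[OF G(1) f(1) h] x' this]
  obtain f' where f': "f' \<in> slice_hom G X" "fmap P G X f' g = x'" by blast
  obtain K k\<^sub>0 k where genK: "generic I R K k\<^sub>0" and k: "k \<in> slice_hom K G" "fmap R K G k k\<^sub>0 = \<tau> G g"
    by (rule enough_genericsE[OF gR G(1) natural_transformation_tot[OF nt G]])
  note K = genericD[OF genK]
  \<comment> \<open>Weak cartesianness is applied to the square at \<open>k\<close>, not at
    \<open>h\<close>: the pair of \<open>g\<close> and the generic element of \<open>R\<close> lifts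
    to \<open>z\<close>.\<close>
  have "weak_pullback J (fobj P K) (fobj P G) (fobj R K) (fobj R G)
      (fmap P K G k) (\<tau> K) (\<tau> G) (fmap R K G k)"
    using wc K(1) G(1) k(1) unfolding weakly_cartesian_def by blast
  from weak_pullback_lift_element[OF this G(2) K(2) k(2)[symmetric]]
  obtain z where z: "z \<in> tot (fobj P K)" "fmap P K G k z = g" by blast
  have "fmap P K G k z = fmap P G G (slice_id G) g"
    using z(2) fmap_id[OF P G] by simp
  \<comment> \<open>With the identity of \<open>G\<close> as the lower map, the filler
    \<open>m\<close> is a section of \<open>k\<close>.\<close>
  from generic_filler[OF gen K(1) G(1) k(1) slice_id_in_hom[OF G(1)] z(1) this]
  obtain m where m: "m \<in> slice_hom G K" "slice_comp G k m = slice_id G" by blast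
  have \<tau>_comp: "\<tau> X (fmap P G X d g) = fmap R K X (slice_comp K d k) k\<^sub>0"
    if d: "d \<in> slice_hom G X" for d
    using nat[OF G(1) X d G(2)] fmap_comp[OF R K(1) G(1) X k(1) d K(2)] k(2) by simp
  have "slice_comp K f k = slice_comp K f' k"
    using K(3)[OF X slice_comp_in_hom[OF K(1) k(1) f(1)] slice_comp_in_hom[OF K(1) k(1) f'(1)]]
      \<tau>_comp[OF f(1)] \<tau>_comp[OF f'(1)] f(2) f'(2) eq\<tau> by simp
  \<comment> \<open>Precomposing with \<open>m\<close> cancels \<open>k\<close>.\<close>
  then have "slice_comp G f (slice_comp G k m) = slice_comp G f' (slice_comp G k m)"
    by (simp add: slice_comp_assoc[OF m(1)])
  then have "f = f'"
    by (simp add: m(2) slice_comp_id[OF f(1)] slice_comp_id[OF f'(1)])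
  then show ?thesis using f(2) f'(2) by simp
qed

theorem corollary7p19:
  fixes I :: "'u set"
    and P R :: "('u, 'u, 'v, 'u) slice_fun"
    and \<tau> :: "('u, 'u) over \<Rightarrow> 'v \<Rightarrow> 'v"
  assumes "polynomial_functor I P"
    and "polynomial_functor I R"
    and "natural_transformation I P R \<tau>"
    and "weakly_cartesian I I P R \<tau>"
  shows "cartesian I I P R \<tau>"
  unfolding cartesian_def
proof (intro ballI)
  fix X Y :: "('u, 'u) over" and h
  assume XY: "X \<in> slice I" "Y \<in> slice I" "h \<in> slice_hom X Y"
  have F: "slice_functor I I P" "slice_functor I I R"
    using assms(1,2) by (simp_all add: polynomial_functor_def)
  show "pullback I (fobj P X) (fobj P Y) (fobj R X) (fobj R Y) (fmap P X Y h) (\<tau> X) (\<tau> Y)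
      (fmap R X Y h)"
    using assms(4) XY
      weakly_cartesian_jointly_injective[OF F assms(1,2)[THEN polynomial_functor_enough_generics]
        assms(3,4) XY]
    by (intro weak_pullback_imp_pullback) (auto simp: weakly_cartesian_def)
qed

end
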